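(* Consider the inexact Uzawa Double Deep Ritz iteration in which each Deep Ritz problem is approximated by a single gradient step: given initial $r^{-1}\in V$ and $u^0\in U$, for $k=0,1,2,\dots$, $r^k\in V$ and $u^{k+1}\in U$ are determined by $$r^k=r^{k-1}-\alpha\big(r^{k-1}-R_V^{-1}(\ell-Bu^k)\big),$$ $$u^{k+1}=u^k-\omega\big(u^{k+1}-u^k-\tau R_U^{-1}B^*r^k\big).$$ Let $(r^*,u^* )\in V\times U$ be the solution of the saddle-point problem $$(r^*,v)_V+b(u^*,v)=\ell(v)\quad\forall v\in V,\qquad b(w,r^* )=0\quad\forall w\in U.$$ Then for $0<\alpha<1$, $0<\omega<1$ and $0<\tau<\frac{2}{M^2}$, the errors satisfy $$e_r^k=r^k-r^*\longrightarrow0,\qquad e_u^k=u^k-u^*\longrightarrow0\qquad\text{as }k\to\infty.$$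
   Context: $U$ and $V$ are real Hilbert spaces with duals $U^*$, $V^*$. $b:U\times V\to\mathbb{R}$ is a bilinear form, $\ell\in V^*$ a continuous linear functional, and $B:U\to V^*$ is the operator defined by $\langle Bu,v\rangle_{V^*,V}=b(u,v)$. There are constants $0<m\le M$ with $m\|u\|_U\le\|Bu\|_{V^*}\le M\|u\|_U$ for all $u\in U$. $B^*:V\to U^*$ is the dual operator, $\langle B^*v,u\rangle_{U^*,U}=b(u,v)$. $R_U:U\to U^*$ and $R_V:V\to V^*$ are the Riesz maps, $\langle R_Uu,w\rangle_{U^*,U}=(u,w)_U$ and $\langle R_Vr,v\rangle_{V^*,V}=(r,v)_V$. The second update is implicit in $u^{k+1}$, as written. *)

theory Defs
  imports "HOL-Analysis.Analysis"
begin

text \<open>The dual of a Hilbert space \<open>'a\<close> is the space \<open>'a \<Rightarrow>\<^sub>L real\<close> of bounded linear functionals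
  with the operator norm.\<close>

definition riesz_map :: "'a::real_inner \<Rightarrow> ('a \<Rightarrow>\<^sub>L real)"
  where "riesz_map x = blinfun_inner_right x"

lemma riesz_map_apply: "blinfun_apply (riesz_map x) y = x \<bullet> y"
  by (simp add: riesz_map_def)

text \<open>The dual \<open>V \<rightarrow> U\<^sup>*\<close> of an operator \<open>B : U \<rightarrow> V\<^sup>*\<close>, with \<open>V\<close> identified with its
  image in \<open>V\<^sup>*\<^sup>*\<close>. It has the intended meaning when \<open>B\<close> is bounded and linear, see the
  lemma below; otherwise \<^const>\<open>Blinfun\<close> may return an unspecified functional.\<close>

definition dual_operator ::
  "('u::real_normed_vector \<Rightarrow> ('v::real_normed_vector \<Rightarrow>\<^sub>L real)) \<Rightarrow> 'v \<Rightarrow> ('u \<Rightarrow>\<^sub>L real)"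
  where "dual_operator B v = Blinfun (\<lambda>u. blinfun_apply (B u) v)"

lemma dual_operator_apply:
  assumes "bounded_linear B"
  shows "blinfun_apply (dual_operator B v) u = blinfun_apply (B u) v"
  unfolding dual_operator_def
  by (subst bounded_linear_Blinfun_apply)
     (use assms in \<open>auto intro: bounded_linear_intros\<close>)

end

theory Submission
  imports Defs
begin

text \<open>
  Put \<open>T = R\<^sub>V\<^sup>-\<^sup>1 B\<close> and \<open>S = R\<^sub>U\<^sup>-\<^sup>1 B\<^sup>*\<close>, which are Hilbert-space adjoints of each other with
  \<open>\<parallel>S v\<parallel> \<le> M \<parallel>v\<parallel>\<close> and \<open>m \<parallel>x\<parallel> \<le> \<parallel>T x\<parallel>\<close>. Subtracting the saddle-point equations
  \<open>r\<^sup>* + T u\<^sup>* = R\<^sub>V\<^sup>-\<^sup>1 l\<close>, \<open>S r\<^sup>* = 0\<close> and solving the second update for \<open>u\<^sup>k\<^sup>+\<^sup>1\<close> turns the iteration into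
  a linear recursion for the errors,

  \<open>\<rho>' = \<rho> - \<alpha> (\<rho> + T e)\<close>, \<open>e' = e + \<sigma> S \<rho>'\<close>, with \<open>\<sigma> = \<omega> \<tau> / (1 + \<omega>)\<close>, so that \<open>\<sigma> M\<^sup>2 < 2\<close>.

  A spectral analysis is avoided by the energy \<open>E = \<parallel>e\<parallel>\<^sup>2 + \<sigma> ((1 - \<alpha>) / \<alpha>) \<parallel>\<rho>\<parallel>\<^sup>2\<close>. In the expansion of
  \<open>\<parallel>e'\<parallel>\<^sup>2\<close> the cross term is \<open>2 \<sigma> e \<bullet> S \<rho>' = 2 \<sigma> T e \<bullet> \<rho>'\<close>, and the first recursion expresses \<open>T e\<close>
  through \<open>\<rho>\<close> and \<open>\<rho>'\<close>. The weight of \<open>\<parallel>\<rho>\<parallel>\<^sup>2\<close> is the one for which, after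
  \<open>2 \<rho> \<bullet> \<rho>' \<le> \<parallel>\<rho>\<parallel>\<^sup>2 + \<parallel>\<rho>'\<parallel>\<^sup>2\<close>, the terms in \<open>\<parallel>\<rho>\<parallel>\<^sup>2\<close> cancel; what is left is
  \<open>E' + \<sigma> (2 - \<sigma> M\<^sup>2) \<parallel>\<rho>'\<parallel>\<^sup>2 \<le> E\<close> (lemma \<open>uzawa_energy_decrease\<close>). Hence \<open>E\<close> converges and the
  decrements drive \<open>\<rho>\<close> to zero. Then \<open>\<alpha> T e = (1 - \<alpha>) \<rho> - \<rho>'\<close> tends to zero, and so does \<open>e\<close> because \<open>T\<close> is
  bounded below (lemma \<open>uzawa_error_tendsto_zero\<close>).

  That \<open>inv riesz_map\<close> really inverts the Riesz maps is the Riesz representation theorem, proved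
  here by the direct method of the calculus of variations.
\<close>

section \<open>Riesz representation\<close>

text \<open>
  The representer of \<open>f\<close> is the minimiser of \<open>J x = \<parallel>x\<parallel>\<^sup>2 / 2 - f x\<close>. The parallelogram law makes \<open>J\<close>
  uniformly convex, so every minimising sequence is Cauchy; at the limit the first variation
  \<open>x \<bullet> v - f v\<close> vanishes.
\<close>

lemma riesz_representation:
  fixes f :: "'a::{real_inner,complete_space} \<Rightarrow>\<^sub>L real"
  shows "\<exists>x. \<forall>v. x \<bullet> v = f v"
proof -
  define J where "J x = x \<bullet> x / 2 - f x" for x
  have lower: "- (norm f)\<^sup>2 / 2 \<le> J x" for x
  proof -
    have "f x \<le> norm f * norm x"
      using norm_blinfun[of f x] by simp
    moreover have "0 \<le> (norm x - norm f)\<^sup>2" by simp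
    then have "norm f * norm x \<le> (norm x)\<^sup>2 / 2 + (norm f)\<^sup>2 / 2"
      by (simp add: power2_diff field_simps)
    ultimately show ?thesis
      unfolding J_def power2_norm_eq_inner[symmetric] by linarith
  qed
  have bdd: "bdd_below (range J)"
    using lower by (intro bdd_belowI[of _ "- (norm f)\<^sup>2 / 2"]) auto
  define i where "i = (INF x. J x)"
  have i_le: "i \<le> J x" for x
    unfolding i_def using bdd by (rule cINF_lower) simp
  have convex: "(norm (x - y))\<^sup>2 \<le> 4 * (J x - i) + 4 * (J y - i)" for x y
  proof -
    have "J ((1/2) *\<^sub>R (x + y)) = (J x + J y) / 2 - (norm (x - y))\<^sup>2 / 8"
      by (simp add: J_def blinfun.add_right blinfun.scaleR_right power2_norm_eq_inner
          inner_add_left inner_add_right inner_diff_left inner_diff_right inner_commute field_simps)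
    with i_le[of "(1/2) *\<^sub>R (x + y)"] show ?thesis by (simp add: field_simps)
  qed
  have "\<exists>x. J x < i + inverse (Suc n)" for n
  proof (rule ccontr)
    assume "\<nexists>x. J x < i + inverse (Suc n)"
    then have "i + inverse (Suc n) \<le> i"
      by (subst (2) i_def) (auto intro!: cINF_greatest simp: not_less)
    then show False by simp
  qed
  then obtain X where X: "\<And>n. J (X n) < i + inverse (Suc n)" by metis
  have "Cauchy X"
  proof (rule metric_CauchyI)
    fix e :: real assume "0 < e"
    then obtain N where N: "inverse (Suc N) < e\<^sup>2 / 8"
      using reals_Archimedean[of "e\<^sup>2 / 8"] by auto
    have small: "J (X n) - i < e\<^sup>2 / 8" if "N \<le> n" for n
    proof -
      have "inverse (real (Suc n)) \<le> inverse (Suc N)"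
        using that by (intro le_imp_inverse_le) auto
      with X[of n] N show ?thesis by linarith
    qed
    have "dist (X p) (X q) < e" if "N \<le> p" "N \<le> q" for p q
    proof -
      have "(norm (X p - X q))\<^sup>2 \<le> 4 * (J (X p) - i) + 4 * (J (X q) - i)"
        by (rule convex)
      also have "\<dots> < 4 * (e\<^sup>2 / 8) + 4 * (e\<^sup>2 / 8)"
        using small[OF that(1)] small[OF that(2)] by (intro add_strict_mono) simp_all
      finally have "(norm (X p - X q))\<^sup>2 < e\<^sup>2" by simp
      then show ?thesis
        using \<open>0 < e\<close> by (simp add: dist_norm power2_less_imp_less)
    qed
    then show "\<exists>N. \<forall>p\<ge>N. \<forall>q\<ge>N. dist (X p) (X q) < e" by blast
  qed
  then obtain x where x: "X \<longlonglongrightarrow> x"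
    using Cauchy_convergent convergent_def by blast
  have "(\<lambda>n. J (X n)) \<longlonglongrightarrow> J x"
    unfolding J_def by (intro tendsto_intros x) auto
  moreover have "(\<lambda>n. i + inverse (real (Suc n))) \<longlonglongrightarrow> i + 0"
    by (intro tendsto_intros LIMSEQ_inverse_real_of_nat)
  ultimately have "J x \<le> i + 0"
    by (rule LIMSEQ_le) (use X in \<open>auto intro: less_imp_le\<close>)
  then have minimal: "J x \<le> J y" for y
    using i_le[of y] by simp
  have "x \<bullet> v = f v" for v
  proof (cases "v = 0")
    case False
    define g where "g = x \<bullet> v - f v"
    \<comment> \<open>the step to the minimum of the quadratic \<open>t \<mapsto> J (x + t v)\<close>\<close>
    define t where "t = - g / (v \<bullet> v)"
    have "J (x + t *\<^sub>R v) = J x + t * g + t\<^sup>2 * (v \<bullet> v) / 2"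
      by (simp add: J_def g_def blinfun.add_right blinfun.scaleR_right inner_add_left
          inner_add_right inner_commute power2_eq_square field_simps)
    also have "\<dots> = J x - g\<^sup>2 / (2 * (v \<bullet> v))"
      using False by (simp add: t_def power2_eq_square field_simps)
    finally have "g\<^sup>2 / (2 * (v \<bullet> v)) \<le> 0"
      using minimal[of "x + t *\<^sub>R v"] by simp
    moreover have "0 < 2 * (v \<bullet> v)" using False by simp
    ultimately have "g\<^sup>2 \<le> 0"
      by (simp add: divide_le_0_iff)
    then show ?thesis by (simp add: g_def)
  qed simp
  then show ?thesis by blast
qed

lemma inner_inv_riesz_map:
  fixes f :: "'a::{real_inner,complete_space} \<Rightarrow>\<^sub>L real"
  shows "inv riesz_map f \<bullet> v = f v"
proof -
  obtain x where "\<forall>v. x \<bullet> v = f v" using riesz_representation by blast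
  then have "riesz_map x = f"
    by (intro blinfun_eqI) (simp add: riesz_map_apply)
  then have "riesz_map (inv riesz_map f) = f"
    by (metis f_inv_into_f rangeI)
  then show ?thesis by (metis riesz_map_apply)
qed

lemma norm_inv_riesz_map:
  fixes f :: "'a::{real_inner,complete_space} \<Rightarrow>\<^sub>L real"
  shows "norm (inv riesz_map f) = norm f"
proof (rule antisym)
  let ?x = "inv riesz_map f"
  show "norm f \<le> norm ?x"
    by (rule norm_blinfun_bound)
       (use Cauchy_Schwarz_ineq2[of ?x] in \<open>simp_all add: inner_inv_riesz_map\<close>)
  have "norm ?x * norm ?x = f ?x"
    using inner_inv_riesz_map[of f ?x] by (simp add: power2_norm_eq_inner[symmetric] power2_eq_square)
  also have "\<dots> \<le> norm f * norm ?x"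
    using norm_blinfun[of f ?x] by simp
  finally show "norm ?x \<le> norm f"
    by (cases "norm ?x = 0") simp_all
qed

section \<open>Energy decay of the error recursion\<close>

text \<open>
  The two cancellations described above: adjointness and the \<open>\<rho>\<close>-recursion remove \<open>T e\<close> from the cross
  term, and the weight \<open>\<sigma> ((1 - \<alpha>) / \<alpha>)\<close> absorbs \<open>\<parallel>\<rho>\<parallel>\<^sup>2\<close>.
\<close>

lemma uzawa_energy_decrease:
  fixes T :: "'u::real_inner \<Rightarrow> 'v::real_inner" and S :: "'v \<Rightarrow> 'u"
  assumes adjoint: "\<And>x v. T x \<bullet> v = x \<bullet> S v"
    and S_bound: "\<And>v. norm (S v) \<le> M * norm v"
    and \<alpha>: "0 < \<alpha>" "\<alpha> \<le> 1" and \<sigma>: "0 < \<sigma>"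
    and \<rho>': "\<rho>' = \<rho> - \<alpha> *\<^sub>R (\<rho> + T e)"
    and e': "e' = e + \<sigma> *\<^sub>R S \<rho>'"
  shows "(norm e')\<^sup>2 + \<sigma> * ((1 - \<alpha>) / \<alpha>) * (norm \<rho>')\<^sup>2 + \<sigma> * (2 - \<sigma> * M\<^sup>2) * (norm \<rho>')\<^sup>2
      \<le> (norm e)\<^sup>2 + \<sigma> * ((1 - \<alpha>) / \<alpha>) * (norm \<rho>)\<^sup>2"
proof -
  define c where "c = (1 - \<alpha>) / \<alpha>"
  have c: "0 \<le> c" "1 / \<alpha> = c + 1"
    using \<alpha> by (simp_all add: c_def field_simps)
  have "\<alpha> *\<^sub>R T e = (1 - \<alpha>) *\<^sub>R \<rho> - \<rho>'"
    by (simp add: \<rho>' algebra_simps)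
  moreover have "T e = (1 / \<alpha>) *\<^sub>R (\<alpha> *\<^sub>R T e)"
    using \<alpha> by simp
  ultimately have "T e = c *\<^sub>R \<rho> - (1 / \<alpha>) *\<^sub>R \<rho>'"
    by (simp add: scaleR_diff_right c_def)
  then have Te: "T e = c *\<^sub>R \<rho> - (c + 1) *\<^sub>R \<rho>'"
    unfolding c(2) .
  have "e \<bullet> S \<rho>' = T e \<bullet> \<rho>'" by (simp add: adjoint)
  also have "\<dots> = c * (\<rho> \<bullet> \<rho>') - (c + 1) * (norm \<rho>')\<^sup>2"
    by (simp add: Te inner_diff_left power2_norm_eq_inner)
  finally have cross: "e \<bullet> S \<rho>' = c * (\<rho> \<bullet> \<rho>') - (c + 1) * (norm \<rho>')\<^sup>2" .
  have "0 \<le> (norm (\<rho> - \<rho>'))\<^sup>2" by simp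
  then have "2 * (\<rho> \<bullet> \<rho>') \<le> (norm \<rho>)\<^sup>2 + (norm \<rho>')\<^sup>2"
    by (simp add: power2_norm_eq_inner inner_diff_left inner_diff_right inner_commute)
  from mult_left_mono[OF this c(1)]
  have "2 * (e \<bullet> S \<rho>') \<le> c * (norm \<rho>)\<^sup>2 - (c + 2) * (norm \<rho>')\<^sup>2"
    unfolding cross by (simp add: algebra_simps)
  moreover have "(norm (S \<rho>'))\<^sup>2 \<le> M\<^sup>2 * (norm \<rho>')\<^sup>2"
    using power_mono[OF S_bound[of \<rho>'], of 2] by (simp add: power_mult_distrib)
  then have "\<sigma> * (norm (S \<rho>'))\<^sup>2 \<le> \<sigma> * (M\<^sup>2 * (norm \<rho>')\<^sup>2)"
    using \<sigma> by (intro mult_left_mono) auto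
  ultimately have "2 * (e \<bullet> S \<rho>') + \<sigma> * (norm (S \<rho>'))\<^sup>2
      \<le> c * (norm \<rho>)\<^sup>2 - (c + 2) * (norm \<rho>')\<^sup>2 + \<sigma> * (M\<^sup>2 * (norm \<rho>')\<^sup>2)"
    by linarith
  then have "\<sigma> * (2 * (e \<bullet> S \<rho>') + \<sigma> * (norm (S \<rho>'))\<^sup>2)
      \<le> \<sigma> * (c * (norm \<rho>)\<^sup>2 - (c + 2) * (norm \<rho>')\<^sup>2 + \<sigma> * (M\<^sup>2 * (norm \<rho>')\<^sup>2))"
    using \<sigma> by (intro mult_left_mono) auto
  moreover have "(norm e')\<^sup>2 = (norm e)\<^sup>2 + \<sigma> * (2 * (e \<bullet> S \<rho>') + \<sigma> * (norm (S \<rho>'))\<^sup>2)"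
    by (simp add: e' power2_norm_eq_inner inner_add_left inner_add_right inner_commute algebra_simps)
  ultimately show ?thesis
    unfolding c_def[symmetric] by (simp add: algebra_simps)
qed

lemma uzawa_error_tendsto_zero:
  fixes T :: "'u::real_inner \<Rightarrow> 'v::real_inner" and S :: "'v \<Rightarrow> 'u"
    and \<rho> :: "nat \<Rightarrow> 'v" and e :: "nat \<Rightarrow> 'u"
  assumes adjoint: "\<And>x v. T x \<bullet> v = x \<bullet> S v"
    and S_bound: "\<And>v. norm (S v) \<le> M * norm v"
    and T_bound: "\<And>x. m * norm x \<le> norm (T x)" and m: "0 < m"
    and \<alpha>: "0 < \<alpha>" "\<alpha> \<le> 1" and \<sigma>: "0 < \<sigma>" "\<sigma> * M\<^sup>2 < 2"
    and \<rho>_Suc: "\<And>k. \<rho> (Suc k) = \<rho> k - \<alpha> *\<^sub>R (\<rho> k + T (e k))"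
    and e_Suc: "\<And>k. e (Suc k) = e k + \<sigma> *\<^sub>R S (\<rho> (Suc k))"
  shows "\<rho> \<longlonglongrightarrow> 0" and "e \<longlonglongrightarrow> 0"
proof -
  define E where "E k = (norm (e k))\<^sup>2 + \<sigma> * ((1 - \<alpha>) / \<alpha>) * (norm (\<rho> k))\<^sup>2" for k
  define d where "d = \<sigma> * (2 - \<sigma> * M\<^sup>2)"
  have d: "0 < d" using \<sigma> by (simp add: d_def)
  have decrease: "E (Suc k) + d * (norm (\<rho> (Suc k)))\<^sup>2 \<le> E k" for k
    unfolding E_def d_def
    by (rule uzawa_energy_decrease[OF adjoint S_bound \<alpha> \<sigma>(1) \<rho>_Suc e_Suc])
  have "E (Suc k) \<le> E k" for k
  proof -
    have "0 \<le> d * (norm (\<rho> (Suc k)))\<^sup>2" using d by simp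
    with decrease[of k] show ?thesis by linarith
  qed
  then have "decseq E" by (rule decseq_SucI)
  moreover have "0 \<le> E k" for k
    using \<alpha> \<sigma> by (simp add: E_def)
  ultimately obtain L where L: "E \<longlonglongrightarrow> L"
    using decseq_convergent[of E 0] by blast
  have "(\<lambda>k. (E k - E (Suc k)) / d) \<longlonglongrightarrow> (L - L) / d"
    using d by (intro tendsto_intros L LIMSEQ_Suc) auto
  then have upper: "(\<lambda>k. (E k - E (Suc k)) / d) \<longlonglongrightarrow> 0" by simp
  have "(norm (\<rho> (Suc k)))\<^sup>2 \<le> (E k - E (Suc k)) / d" for k
    using decrease[of k] d by (simp add: field_simps)
  then have "(\<lambda>k. (norm (\<rho> (Suc k)))\<^sup>2) \<longlonglongrightarrow> 0"
    by (intro tendsto_sandwich[OF _ _ tendsto_const upper]) auto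
  then have "(\<lambda>k. sqrt ((norm (\<rho> (Suc k)))\<^sup>2)) \<longlonglongrightarrow> sqrt 0"
    by (rule tendsto_real_sqrt)
  then have "(\<lambda>k. \<rho> (Suc k)) \<longlonglongrightarrow> 0"
    by (simp add: tendsto_norm_zero_iff)
  then show \<rho>: "\<rho> \<longlonglongrightarrow> 0" by (rule LIMSEQ_imp_Suc)
  have "(\<lambda>k. norm ((1 - \<alpha>) *\<^sub>R \<rho> k - \<rho> (Suc k)) / (\<alpha> * m))
      \<longlonglongrightarrow> norm ((1 - \<alpha>) *\<^sub>R (0::'v) - 0) / (\<alpha> * m)"
    using \<alpha> m by (intro tendsto_intros \<rho> LIMSEQ_Suc) auto
  then have limit: "(\<lambda>k. norm ((1 - \<alpha>) *\<^sub>R \<rho> k - \<rho> (Suc k)) / (\<alpha> * m)) \<longlonglongrightarrow> 0" by simp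
  have "norm (e k) \<le> norm ((1 - \<alpha>) *\<^sub>R \<rho> k - \<rho> (Suc k)) / (\<alpha> * m)" for k
  proof -
    have "\<alpha> *\<^sub>R T (e k) = (1 - \<alpha>) *\<^sub>R \<rho> k - \<rho> (Suc k)"
      by (simp add: \<rho>_Suc algebra_simps)
    then have "norm ((1 - \<alpha>) *\<^sub>R \<rho> k - \<rho> (Suc k)) = \<alpha> * norm (T (e k))"
      using \<alpha> by (metis norm_scaleR abs_of_pos)
    moreover have "\<alpha> * (m * norm (e k)) \<le> \<alpha> * norm (T (e k))"
      using T_bound \<alpha> by (intro mult_left_mono) auto
    ultimately show ?thesis
      using \<alpha> m by (simp add: field_simps)
  qed
  then have "(\<lambda>k. norm (e k)) \<longlonglongrightarrow> 0"
    by (intro tendsto_sandwich[OF _ _ tendsto_const limit]) auto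
  then show "e \<longlonglongrightarrow> 0" by (simp add: tendsto_norm_zero_iff)
qed

section \<open>Convergence of the iteration\<close>

theorem theorem4p2:
  fixes b :: "'u::{real_inner,complete_space} \<Rightarrow> 'v::{real_inner,complete_space} \<Rightarrow> real"
    and l :: "'v \<Rightarrow>\<^sub>L real"
    and B :: "'u \<Rightarrow> ('v \<Rightarrow>\<^sub>L real)"
    and m M \<alpha> \<omega> \<tau> :: real
    and r :: "int \<Rightarrow> 'v" and u :: "nat \<Rightarrow> 'u"
    and rstar :: 'v and ustar :: 'u
  assumes "bilinear b"
    and "\<And>x v. blinfun_apply (B x) v = b x v"
    and "0 < m" and "m \<le> M"
    and "\<And>x. m * norm x \<le> norm (B x)"
    and "\<And>x. norm (B x) \<le> M * norm x"
    and "\<And>v. rstar \<bullet> v + b ustar v = blinfun_apply l v"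
    and "\<And>w. b w rstar = 0"
    and "\<And>k::nat. r (int k) = r (int k - 1)
           - \<alpha> *\<^sub>R (r (int k - 1) - inv riesz_map (l - B (u k)))"
    and "\<And>k::nat. u (k + 1) = u k
           - \<omega> *\<^sub>R (u (k + 1) - u k - \<tau> *\<^sub>R inv riesz_map (dual_operator B (r (int k))))"
    and "0 < \<alpha>" and "\<alpha> < 1"
    and "0 < \<omega>" and "\<omega> < 1"
    and "0 < \<tau>" and "\<tau> < 2 / M\<^sup>2"
  shows "(\<lambda>k::nat. r (int k) - rstar) \<longlonglongrightarrow> 0 \<and> (\<lambda>k::nat. u k - ustar) \<longlonglongrightarrow> 0"
proof -
  note bil = assms(1) and Bb = assms(2) and m = assms(3) and mM = assms(4)
    and lower = assms(5) and upper = assms(6) and saddle1 = assms(7) and saddle2 = assms(8)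
    and r_step = assms(9) and u_step = assms(10)
  have "bounded_linear B"
    by (rule bounded_linear_intro[where K = M])
       (use upper in \<open>auto intro!: blinfun_eqI simp: blinfun.add_left blinfun.scaleR_left Bb
          bilinear_ladd[OF bil] bilinear_lmul[OF bil] mult.commute\<close>)
  then have dual: "dual_operator B v x = b x v" for v x
    by (simp add: dual_operator_apply Bb)
  define T where "T x = inv riesz_map (B x)" for x
  define S where "S v = inv riesz_map (dual_operator B v)" for v
  have T: "T x \<bullet> v = b x v" for x v
    by (simp add: T_def inner_inv_riesz_map Bb)
  have S: "S v \<bullet> x = b x v" for x v
    by (simp add: S_def inner_inv_riesz_map dual)
  have adjoint: "T x \<bullet> v = x \<bullet> S v" for x v
    by (simp add: T S inner_commute[of x])
  have T_lower: "m * norm x \<le> norm (T x)" and T_upper: "norm (T x) \<le> M * norm x" for x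
    using lower[of x] upper[of x] by (simp_all add: T_def norm_inv_riesz_map)
  have S_upper: "norm (S v) \<le> M * norm v" for v
  proof -
    have "norm (S v) * norm (S v) = T (S v) \<bullet> v"
      by (simp add: adjoint power2_norm_eq_inner[symmetric] power2_eq_square)
    also have "\<dots> \<le> norm (T (S v)) * norm v" by (rule norm_cauchy_schwarz)
    also have "\<dots> \<le> M * norm (S v) * norm v"
      using T_upper by (intro mult_right_mono) auto
    finally have "norm (S v) * norm (S v) \<le> (M * norm v) * norm (S v)"
      by (simp add: mult_ac)
    then show ?thesis
      using m mM by (cases "norm (S v) = 0") simp_all
  qed
  \<comment> \<open>The index of \<open>\<rho>\<close> is shifted so that \<open>\<rho> 0\<close> is the error of the initial residual \<open>r (-1)\<close>.\<close>
  define \<rho> where "\<rho> k = r (int k - 1) - rstar" for k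
  define e where "e k = u k - ustar" for k
  define \<sigma> where "\<sigma> = \<omega> * \<tau> / (1 + \<omega>)"
  have residual: "inv riesz_map (l - B (u k)) = rstar - T (e k)" for k
    by (rule vector_eq_ldot[THEN iffD1])
       (simp add: inner_commute[of _ "_ - _"] inner_commute[of _ "inv _ _"] inner_inv_riesz_map
         inner_diff_left T e_def blinfun.diff_left Bb saddle1[symmetric] bilinear_lsub[OF bil])
  have \<rho>_Suc: "\<rho> (Suc k) = \<rho> k - \<alpha> *\<^sub>R (\<rho> k + T (e k))" for k
    using r_step[of k] by (simp add: \<rho>_def residual algebra_simps)
  have S_r: "S (r (int k)) = S (\<rho> (Suc k))" for k
    by (rule vector_eq_ldot[THEN iffD1])
       (simp add: inner_commute[of _ "S _"] S \<rho>_def bilinear_rsub[OF bil] saddle2)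
  have e_Suc: "e (Suc k) = e k + \<sigma> *\<^sub>R S (\<rho> (Suc k))" for k
  proof -
    \<comment> \<open>the implicit update, solved for the increment\<close>
    have "(1 + \<omega>) *\<^sub>R (e (Suc k) - e k) = (\<omega> * \<tau>) *\<^sub>R S (\<rho> (Suc k))"
      using u_step[of k] by (simp add: e_def S_def[symmetric] S_r algebra_simps)
    moreover have "e (Suc k) - e k = (1 / (1 + \<omega>)) *\<^sub>R ((1 + \<omega>) *\<^sub>R (e (Suc k) - e k))"
      using \<open>0 < \<omega>\<close> by simp
    ultimately have "e (Suc k) - e k = \<sigma> *\<^sub>R S (\<rho> (Suc k))"
      by (simp add: \<sigma>_def)
    then show ?thesis by (simp add: algebra_simps)
  qed
  have \<sigma>_pos: "0 < \<sigma>" using \<open>0 < \<omega>\<close> \<open>0 < \<tau>\<close> by (simp add: \<sigma>_def)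
  have "\<sigma> \<le> \<tau>" using \<open>0 < \<omega>\<close> \<open>0 < \<tau>\<close> by (simp add: \<sigma>_def field_simps)
  then have "\<sigma> * M\<^sup>2 \<le> \<tau> * M\<^sup>2" by (rule mult_right_mono) simp
  also have "\<dots> < 2" using \<open>\<tau> < 2 / M\<^sup>2\<close> m mM by (simp add: field_simps)
  finally have \<sigma>_M: "\<sigma> * M\<^sup>2 < 2" .
  note limits = uzawa_error_tendsto_zero[where T = T and S = S and \<rho> = \<rho> and e = e,
      OF adjoint S_upper T_lower m \<open>0 < \<alpha>\<close>
      less_imp_le[OF \<open>\<alpha> < 1\<close>] \<sigma>_pos \<sigma>_M \<rho>_Suc e_Suc]
  show ?thesis
    using LIMSEQ_Suc[OF limits(1)] limits(2) by (simp add: \<rho>_def e_def[abs_def])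
qed

end
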